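(* Let $d\ge 2$, let $\kappa_0\in\{+1,-1\}$, let $\nu_0\ge 1$ be an integer, and consider an admissible triplet $(d,\alpha,\beta)_{\pm}$ (sign $+$ for $\kappa_0=+1$, sign $-$ for $\kappa_0=-1$) with $\alpha>d$ and $\beta=\kappa_0(d^{\nu_0}-\alpha)$, with associated map $T:\mathbb{N}\to\mathbb{N}$. For all integers $a\ge 1$, $k\ge 0$ and $r\in\{1,\ldots,d-1\}$ such that $ad^k+\kappa_0 r\ge 1$, writing $k=q_0\nu_0+r_0$ with integers $q_0\ge 0$ and $0\le r_0<\nu_0$, we have $$T^{(k)}(ad^k+\kappa_0 r)=\begin{cases} a\alpha^{q_0}+\kappa_0 r & \text{if } k\equiv 0\pmod{\nu_0},\\ a\alpha^{q_0+1}+\kappa_0 r\,d^{\nu_0-r_0} & \text{if } k\not\equiv 0\pmod{\nu_0}.\end{cases}$$ Thus, $$\sigma_\infty(ad^k+\kappa_0 r)=\begin{cases} \sigma_\infty(a\alpha^{q_0}+\kappa_0 r)+k & \text{if } k\equiv 0\pmod{\nu_0},\\ \sigma_\infty(a\alpha^{q_0+1}+\kappa_0 r\,d^{\nu_0-r_0})+k & \text{if } k\not\equiv 0\pmod{\nu_0}.\end{cases}$$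
   Context: $\mathbb{N}=\{1,2,3,\ldots\}$. For an integer $x$ and $d\ge 2$, $[x]_d$ denotes the remainder of $x$ in the Euclidean division by $d$, with $0\le [x]_d<d$. Let $\alpha>d\ge 2$ be positive integers, $\beta$ an integer (possibly negative), $\kappa_0\in\{+1,-1\}$, with $\alpha\not\equiv 0\pmod d$ and $\beta\not\equiv 0\pmod d$. The triplet $(d,\alpha,\beta)_{+}$ (for $\kappa_0=+1$) or $(d,\alpha,\beta)_{-}$ (for $\kappa_0=-1$) is associated with the map $T$ given by $T(n)=n/d$ if $n\equiv 0\pmod d$ and $T(n)=(\alpha n+\beta[\kappa_0 n]_d)/d$ if $n\not\equiv 0\pmod d$. $T^{(k)}$ denotes the $k$-th iterate of $T$ ($T^{(0)}$ is the identity). A cycle with $k$ elements of the triplet is a set of $k$ distinct positive integers $\{\omega,T(\omega),\ldots,T^{(k-1)}(\omega)\}$ with $T^{(k)}(\omega)=\omega$; it is denoted $\Omega(\omega)$, where $\omega$ is its smallest element. The triplet is admissible if and only if it satisfies the condition $\alpha+\kappa_0\beta>\frac{\kappa_0-1}{2}$ and $\alpha+\kappa_0\beta\equiv 0\pmod d$ (which is equivalent to $T$ being well defined from $\mathbb{N}$ to $\mathbb{N}$), and it has at least one cycle. Total stopping time: let $\Omega(\omega_1),\Omega(\omega_2),\ldots$ be the cycles of the admissible triplet, $\omega_i$ being the smallest element of its cycle. For $n\in\mathbb{N}$, $\sigma_\infty(n)$ is the smallest integer $k\ge 0$ such that $T^{(k)}(n)\in\{\omega_1,\omega_2,\ldots\}$,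 and $\sigma_\infty(n)=\infty$ if no such $k$ exists (with $\infty+k=\infty$).
   Formalization: The formula for σ∞ is stated only when k ≤ σ∞(ad^k+κ₀r), a condition the equality itself forces; without it the claim fails, e.g. (2,3,1)₋ with ν₀=a=k=r=1 gives σ∞(1)=0 but σ∞(2)+1=2. *)

theory Defs
  imports Main "HOL-Library.Extended_Nat"
begin

text \<open>
  A triplet (with its sign) is given by integers \<open>d\<close>, \<open>\<alpha>\<close>, \<open>\<beta>\<close>, \<open>\<kappa>\<close>, where \<open>\<kappa>\<close> is \<open>1\<close> or \<open>-1\<close>.
  The map is defined on all integers; the positive integers are carved out below, in the
  definition of cycles.  As \<open>d > 0\<close>, \<open>x mod d\<close> is the Euclidean remainder also for negative \<open>x\<close>,
  and if \<open>d\<close> divides \<open>\<alpha> + \<kappa> * \<beta>\<close> then both divisions by \<open>d\<close> are exact.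
\<close>

definition T :: "int \<Rightarrow> int \<Rightarrow> int \<Rightarrow> int \<Rightarrow> int \<Rightarrow> int" where
  "T d \<alpha> \<beta> \<kappa> n = (if n mod d = 0 then n div d else (\<alpha> * n + \<beta> * ((\<kappa> * n) mod d)) div d)"

definition triplet :: "int \<Rightarrow> int \<Rightarrow> int \<Rightarrow> int \<Rightarrow> bool" where
  "triplet d \<alpha> \<beta> \<kappa> \<longleftrightarrow>
     2 \<le> d \<and> d < \<alpha> \<and> \<kappa> \<in> {1, -1} \<and> \<alpha> mod d \<noteq> 0 \<and> \<beta> mod d \<noteq> 0"

definition is_cycle :: "int \<Rightarrow> int \<Rightarrow> int \<Rightarrow> int \<Rightarrow> int set \<Rightarrow> bool" where
  "is_cycle d \<alpha> \<beta> \<kappa> C \<longleftrightarrow>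
     (\<exists>\<omega> k. 1 \<le> k \<and> C = (\<lambda>j. (T d \<alpha> \<beta> \<kappa> ^^ j) \<omega>) ` {..<k} \<and>
        inj_on (\<lambda>j. (T d \<alpha> \<beta> \<kappa> ^^ j) \<omega>) {..<k} \<and>
        (\<forall>x\<in>C. 1 \<le> x) \<and> (T d \<alpha> \<beta> \<kappa> ^^ k) \<omega> = \<omega>)"

text \<open>The bound \<open>(\<kappa> - 1) div 2\<close> is exact: it is \<open>0\<close> for \<open>\<kappa> = 1\<close> and \<open>-1\<close> for \<open>\<kappa> = -1\<close>.\<close>

definition admissible :: "int \<Rightarrow> int \<Rightarrow> int \<Rightarrow> int \<Rightarrow> bool" where
  "admissible d \<alpha> \<beta> \<kappa> \<longleftrightarrow>
     triplet d \<alpha> \<beta> \<kappa> \<and> \<alpha> + \<kappa> * \<beta> > (\<kappa> - 1) div 2 \<and> (\<alpha> + \<kappa> * \<beta>) mod d = 0 \<and>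
     (\<exists>C. is_cycle d \<alpha> \<beta> \<kappa> C)"

definition cycle_minima :: "int \<Rightarrow> int \<Rightarrow> int \<Rightarrow> int \<Rightarrow> int set" where
  "cycle_minima d \<alpha> \<beta> \<kappa> = {Min C | C. is_cycle d \<alpha> \<beta> \<kappa> C}"

definition sigma_inf :: "int \<Rightarrow> int \<Rightarrow> int \<Rightarrow> int \<Rightarrow> int \<Rightarrow> enat" where
  "sigma_inf d \<alpha> \<beta> \<kappa> n =
     (if \<exists>k. (T d \<alpha> \<beta> \<kappa> ^^ k) n \<in> cycle_minima d \<alpha> \<beta> \<kappa>
      then enat (LEAST k. (T d \<alpha> \<beta> \<kappa> ^^ k) n \<in> cycle_minima d \<alpha> \<beta> \<kappa>)
      else \<infinity>)"

end

theory Submission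
  imports Defs
begin

text \<open>
  The choice \<open>\<beta> = \<kappa> * (d ^ \<nu> - \<alpha>)\<close> makes the non-divisible branch of the map multiply the
  leading part of \<open>m * d + \<kappa> * r\<close> by \<open>\<alpha>\<close> and the residue by \<open>d ^ \<nu>\<close>: as \<open>\<kappa> * \<kappa> = 1\<close>, the
  remainder of \<open>\<kappa> * n\<close> is \<open>r\<close>, and in \<open>\<alpha> * n + \<beta> * r\<close> the two terms \<open>\<alpha> * \<kappa> * r\<close> cancel, so that
  the image is \<open>\<alpha> * m + \<kappa> * r * d ^ (\<nu> - 1)\<close> (\<open>T_digit\<close>).  If \<open>m\<close> is divisible by a high
  power of \<open>d\<close>, the next \<open>\<nu> - 1\<close> steps are plain divisions by \<open>d\<close>, which bring the residue back to
  \<open>\<kappa> * r\<close>.  A full block of \<open>\<nu>\<close> steps therefore trades a factor \<open>d ^ \<nu>\<close> of the leading part for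
  one factor \<open>\<alpha>\<close>.  After \<open>q\<close> such blocks (\<open>T_blocks\<close>) one stops \<open>r\<^sub>0\<close> steps into the next one
  (\<open>T_block\<close>); if \<open>r\<^sub>0 > 0\<close> the factor \<open>\<alpha>\<close> of that block has been gained already, and
  \<open>\<nu> - r\<^sub>0\<close> divisions are outstanding.

  The claim on stopping times is a property of first hitting times under any iteration
  (\<open>sigma_inf_shift\<close>).  Its hypothesis that no cycle minimum is met before step \<open>k\<close>
  cannot be omitted: from inside a cycle, an orbit that has passed the minimum returns
  to it only after going round.
\<close>

lemma T_mult:
  assumes "d > 0"
  shows "T d \<alpha> \<beta> \<kappa> (d * x) = x"
  using assms by (simp add: T_def)

lemma T_funpow_mult:
  assumes "d > 0"
  shows "(T d \<alpha> \<beta> \<kappa> ^^ i) (d ^ i * x) = x"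
proof (induction i)
  case (Suc i)
  have "T d \<alpha> \<beta> \<kappa> (d ^ Suc i * x) = d ^ i * x"
    using T_mult[OF assms, of \<alpha> \<beta> \<kappa> "d ^ i * x"] by (simp add: mult.assoc)
  with Suc show ?case by (simp add: funpow_Suc_right del: funpow.simps power_Suc)
qed simp

text \<open>
  For \<open>\<kappa> = -1\<close> the value \<open>r\<close> is the remainder of \<open>- n\<close>, not of \<open>n\<close>; this is why the map
  takes the remainder of \<open>\<kappa> * n\<close>.
\<close>

lemma T_digit:
  assumes r: "0 < r" "r < d" and \<kappa>: "\<kappa> \<in> {1, -1}" and \<beta>: "\<beta> = \<kappa> * (d ^ Suc \<nu> - \<alpha>)"
  shows "T d \<alpha> \<beta> \<kappa> (m * d + \<kappa> * r) = \<alpha> * m + \<kappa> * r * d ^ \<nu>"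
proof -
  let ?n = "m * d + \<kappa> * r"
  have \<kappa>\<kappa>: "\<kappa> * \<kappa> = 1" using \<kappa> by auto
  have "\<kappa> * ?n = \<kappa> * m * d + (\<kappa> * \<kappa>) * r" by (simp add: algebra_simps)
  also have "\<dots> = r + \<kappa> * m * d" using \<kappa>\<kappa> by simp
  finally have rem: "(\<kappa> * ?n) mod d = r" using r by simp
  have nz: "?n mod d \<noteq> 0"
  proof
    assume "?n mod d = 0"
    then have "d dvd \<kappa> * ?n" by (simp add: mod_eq_0_iff_dvd)
    with rem r show False by simp
  qed
  have "\<alpha> * ?n + \<beta> * r = d * (\<alpha> * m + \<kappa> * r * d ^ \<nu>)"
    by (simp add: \<beta> algebra_simps)
  with nz rem r show ?thesis by (simp add: T_def)
qed

text \<open>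
  The first \<open>Suc i\<close> steps of a block of length \<open>Suc \<nu>\<close>: one step that multiplies by \<open>\<alpha>\<close>, then
  \<open>i\<close> divisions.  The factor \<open>d ^ j\<close> is what the leading part keeps for later blocks.
\<close>

lemma T_block:
  assumes r: "0 < r" "r < d" and \<kappa>: "\<kappa> \<in> {1, -1}" and \<beta>: "\<beta> = \<kappa> * (d ^ Suc \<nu> - \<alpha>)"
    and i: "i \<le> \<nu>"
  shows "(T d \<alpha> \<beta> \<kappa> ^^ Suc i) (a * d ^ (Suc i + j) + \<kappa> * r) = \<alpha> * a * d ^ j + \<kappa> * r * d ^ (\<nu> - i)"
proof -
  have "T d \<alpha> \<beta> \<kappa> (a * d ^ (Suc i + j) + \<kappa> * r) = \<alpha> * (a * d ^ (i + j)) + \<kappa> * r * d ^ \<nu>"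
    using T_digit[OF r \<kappa> \<beta>, of "a * d ^ (i + j)"] by (simp add: mult_ac)
  also have "d ^ \<nu> = d ^ i * d ^ (\<nu> - i)"
    using i by (simp flip: power_add)
  also have "\<alpha> * (a * d ^ (i + j)) + \<kappa> * r * (d ^ i * d ^ (\<nu> - i)) =
      d ^ i * (\<alpha> * a * d ^ j + \<kappa> * r * d ^ (\<nu> - i))"
    by (simp add: algebra_simps power_add)
  finally show ?thesis
    using r by (simp add: funpow_Suc_right T_funpow_mult del: funpow.simps)
qed

lemma T_blocks:
  assumes r: "0 < r" "r < d" and \<kappa>: "\<kappa> \<in> {1, -1}" and \<beta>: "\<beta> = \<kappa> * (d ^ Suc \<nu> - \<alpha>)"
  shows "(T d \<alpha> \<beta> \<kappa> ^^ (q * Suc \<nu>)) (a * d ^ (q * Suc \<nu> + j) + \<kappa> * r) = a * \<alpha> ^ q * d ^ j + \<kappa> * r"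
proof (induction q arbitrary: a)
  case (Suc q)
  let ?n = "a * d ^ (Suc q * Suc \<nu> + j) + \<kappa> * r"
  have "(T d \<alpha> \<beta> \<kappa> ^^ (Suc q * Suc \<nu>)) ?n = (T d \<alpha> \<beta> \<kappa> ^^ (q * Suc \<nu>)) ((T d \<alpha> \<beta> \<kappa> ^^ Suc \<nu>) ?n)"
    unfolding mult_Suc add.commute[of "Suc \<nu>"] funpow_add by simp
  also have "(T d \<alpha> \<beta> \<kappa> ^^ Suc \<nu>) ?n = \<alpha> * a * d ^ (q * Suc \<nu> + j) + \<kappa> * r"
    using T_block[OF r \<kappa> \<beta> order_refl, of a "q * Suc \<nu> + j"] by (simp add: add_ac)
  finally show ?case
    using Suc[of "\<alpha> * a"] by (simp add: mult_ac del: funpow.simps)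
qed simp

lemma sigma_inf_le:
  assumes "(T d \<alpha> \<beta> \<kappa> ^^ j) n \<in> cycle_minima d \<alpha> \<beta> \<kappa>"
  shows "sigma_inf d \<alpha> \<beta> \<kappa> n \<le> enat j"
  using assms by (auto simp: sigma_inf_def intro: Least_le)

lemma sigma_inf_shift:
  assumes k: "enat k \<le> sigma_inf d \<alpha> \<beta> \<kappa> n"
  shows "sigma_inf d \<alpha> \<beta> \<kappa> n = sigma_inf d \<alpha> \<beta> \<kappa> ((T d \<alpha> \<beta> \<kappa> ^^ k) n) + enat k"
proof -
  define P where "P j \<longleftrightarrow> (T d \<alpha> \<beta> \<kappa> ^^ j) n \<in> cycle_minima d \<alpha> \<beta> \<kappa>" for j
  have hits_after: "k \<le> j" if "P j" for j
    using order_trans[OF k sigma_inf_le] that by (simp add: P_def)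
  have shifted: "(T d \<alpha> \<beta> \<kappa> ^^ j) ((T d \<alpha> \<beta> \<kappa> ^^ k) n) \<in> cycle_minima d \<alpha> \<beta> \<kappa> \<longleftrightarrow> P (j + k)" for j
    by (simp add: P_def funpow_add)
  have ex: "(\<exists>j. P j) \<longleftrightarrow> (\<exists>j. P (j + k))"
    by (metis hits_after le_add_diff_inverse2)
  have least: "(LEAST j. P j) = (LEAST j. P (j + k)) + k" if "P i" for i
  proof (rule Least_equality)
    have "P (i - k + k)" using that hits_after[OF that] by simp
    then show "P ((LEAST j. P (j + k)) + k)" by (rule LeastI)
  next
    fix j assume "P j"
    then have "P (j - k + k)" and "k \<le> j" using hits_after by auto
    then show "(LEAST j. P (j + k)) + k \<le> j"
      using Least_le[of "\<lambda>j. P (j + k)" "j - k"] by simp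
  qed
  show ?thesis
    unfolding sigma_inf_def shifted P_def[symmetric] using ex least by auto
qed

theorem theorem3p2:
  fixes d \<alpha> \<beta> \<kappa>\<^sub>0 a r :: int and \<nu>\<^sub>0 k q\<^sub>0 r\<^sub>0 :: nat
  assumes "d \<ge> 2" and "\<kappa>\<^sub>0 \<in> {1, -1}" and "\<nu>\<^sub>0 \<ge> 1"
    and "admissible d \<alpha> \<beta> \<kappa>\<^sub>0" and "\<alpha> > d" and "\<beta> = \<kappa>\<^sub>0 * (d ^ \<nu>\<^sub>0 - \<alpha>)"
    and "a \<ge> 1" and "r \<in> {1..d - 1}" and "a * d ^ k + \<kappa>\<^sub>0 * r \<ge> 1"
    and "k = q\<^sub>0 * \<nu>\<^sub>0 + r\<^sub>0" and "r\<^sub>0 < \<nu>\<^sub>0"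
  shows "(T d \<alpha> \<beta> \<kappa>\<^sub>0 ^^ k) (a * d ^ k + \<kappa>\<^sub>0 * r) =
           (if k mod \<nu>\<^sub>0 = 0 then a * \<alpha> ^ q\<^sub>0 + \<kappa>\<^sub>0 * r
            else a * \<alpha> ^ (q\<^sub>0 + 1) + \<kappa>\<^sub>0 * r * d ^ (\<nu>\<^sub>0 - r\<^sub>0)) \<and>
         (enat k \<le> sigma_inf d \<alpha> \<beta> \<kappa>\<^sub>0 (a * d ^ k + \<kappa>\<^sub>0 * r) \<longrightarrow>
          sigma_inf d \<alpha> \<beta> \<kappa>\<^sub>0 (a * d ^ k + \<kappa>\<^sub>0 * r) =
           (if k mod \<nu>\<^sub>0 = 0 then sigma_inf d \<alpha> \<beta> \<kappa>\<^sub>0 (a * \<alpha> ^ q\<^sub>0 + \<kappa>\<^sub>0 * r) + enat k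
            else sigma_inf d \<alpha> \<beta> \<kappa>\<^sub>0 (a * \<alpha> ^ (q\<^sub>0 + 1) + \<kappa>\<^sub>0 * r * d ^ (\<nu>\<^sub>0 - r\<^sub>0)) + enat k))"
proof -
  have r: "0 < r" "r < d" using assms by auto
  \<comment> \<open>A block has one step of the non-divisible branch and \<open>\<nu>\<close> divisions.\<close>
  obtain \<nu> where \<nu>: "\<nu>\<^sub>0 = Suc \<nu>" using \<open>\<nu>\<^sub>0 \<ge> 1\<close> by (cases \<nu>\<^sub>0) auto
  have \<beta>: "\<beta> = \<kappa>\<^sub>0 * (d ^ Suc \<nu> - \<alpha>)" using assms(6) \<nu> by simp
  let ?n = "a * d ^ k + \<kappa>\<^sub>0 * r"
  let ?m = "if k mod \<nu>\<^sub>0 = 0 then a * \<alpha> ^ q\<^sub>0 + \<kappa>\<^sub>0 * r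
            else a * \<alpha> ^ (q\<^sub>0 + 1) + \<kappa>\<^sub>0 * r * d ^ (\<nu>\<^sub>0 - r\<^sub>0)"
  have k_mod: "k mod \<nu>\<^sub>0 = r\<^sub>0" using assms(10,11) by simp
  have "k = r\<^sub>0 + q\<^sub>0 * Suc \<nu>" using assms(10) \<nu> by simp
  then have "(T d \<alpha> \<beta> \<kappa>\<^sub>0 ^^ k) ?n = (T d \<alpha> \<beta> \<kappa>\<^sub>0 ^^ r\<^sub>0) (a * \<alpha> ^ q\<^sub>0 * d ^ r\<^sub>0 + \<kappa>\<^sub>0 * r)"
    using T_blocks[OF r assms(2) \<beta>, of q\<^sub>0 a r\<^sub>0]
    by (simp add: funpow_add add.commute del: mult_Suc_right)
  also have "\<dots> = ?m"
  proof (cases r\<^sub>0)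
    case 0
    then show ?thesis using k_mod by simp
  next
    case (Suc i)
    then have "i \<le> \<nu>" using assms(11) \<nu> by simp
    from T_block[OF r assms(2) \<beta> this, of "a * \<alpha> ^ q\<^sub>0" 0] show ?thesis
      using Suc k_mod \<nu> by (simp add: mult_ac del: funpow.simps)
  qed
  finally have iterate: "(T d \<alpha> \<beta> \<kappa>\<^sub>0 ^^ k) ?n = ?m" .
  moreover have "sigma_inf d \<alpha> \<beta> \<kappa>\<^sub>0 ?n = sigma_inf d \<alpha> \<beta> \<kappa>\<^sub>0 ?m + enat k"
    if "enat k \<le> sigma_inf d \<alpha> \<beta> \<kappa>\<^sub>0 ?n"
    using sigma_inf_shift[OF that] unfolding iterate .
  ultimately show ?thesis by (auto split: if_splits)
qed

end
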